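(* Let $N\geq 3$, let $\Omega\subset\mathbb{R}^N$ be a connected open set and let $u:\Omega\to\mathbb{R}^N$ be a nonconstant Lebesgue measurable vector field satisfying $|u|=1$ a.e. in $\Omega$ together with the kinetic formulation $$v\cdot\nabla_x\chi(\cdot,\xi)=0\quad\text{distributionally in }\Omega,\ \text{ for every }\xi\in\mathbb{S}^{N-1}\text{ and every }v\in\xi^\perp .$$ Then $u$ coincides with the vortex vector field $u^\star$ or $-u^\star$ up to a translation, i.e., there exist a point $P\in\mathbb{R}^N$ and a sign $\gamma\in\{\pm1\}$ such that $u(x)=\gamma\,u^\star(x-P)$ for a.e. $x\in\Omega$.
   Context: $|\cdot|$ is the Euclidean norm in $\mathbb{R}^N$ and $\mathbb{S}^{N-1}$ the unit sphere. The vortex vector field is $u^\star(x)=\frac{x}{|x|}$ for $x\in\mathbb{R}^N\setminus\{0\}$. For $\xi\in\mathbb{S}^{N-1}$, $\xi^\perp=\{v\in\mathbb{R}^N: v\cdot\xi=0\}$, and $\chi(\cdot,\xi):\Omega\to\{0,1\}$ is defined from $u$ by $\chi(x,\xi)=1$ if $u(x)\cdot\xi>0$ and $\chi(x,\xi)=0$ if $u(x)\cdot\xi\leq 0$. Vector fields are identified when they agree a.e.; nonconstant means not a.e. equal to a constant vector. *)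

theory Defs
  imports "HOL-Analysis.Analysis"
begin

primrec cont_diff :: "nat \<Rightarrow> ('a::euclidean_space \<Rightarrow> real) \<Rightarrow> bool" where
  "cont_diff 0 f \<longleftrightarrow> continuous_on UNIV f"
| "cont_diff (Suc k) f \<longleftrightarrow> (\<forall>x. f differentiable (at x)) \<and>
     (\<forall>v. cont_diff k (\<lambda>x. frechet_derivative f (at x) v))"

text \<open>The space of smooth functions with compact support in \<open>\<Omega>\<close>, each extended by zero
  to the whole space.\<close>

definition test_functions :: "'a::euclidean_space set \<Rightarrow> ('a \<Rightarrow> real) set" where
  "test_functions \<Omega> = {\<phi>. (\<forall>k. cont_diff k \<phi>) \<and>
     compact (closure {x. \<phi> x \<noteq> 0}) \<and> closure {x. \<phi> x \<noteq> 0} \<subseteq> \<Omega>}"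

text \<open>The distribution \<open>v \<cdot> \<nabla>f\<close> on \<open>\<Omega>\<close>: on test functions, the Frechet derivative in direction
  \<open>v\<close> is \<open>v \<cdot> \<nabla>\<phi>\<close>. It is meant for locally integrable \<open>f\<close>, for which the integral exists.\<close>

definition distr_dir_deriv ::
  "'a::euclidean_space set \<Rightarrow> 'a \<Rightarrow> ('a \<Rightarrow> real) \<Rightarrow> ('a \<Rightarrow> real) \<Rightarrow> real" where
  "distr_dir_deriv \<Omega> v f \<phi> =
     - (LINT x|lebesgue_on \<Omega>. f x * frechet_derivative \<phi> (at x) v)"

definition chi :: "('a \<Rightarrow> 'b::euclidean_space) \<Rightarrow> 'a \<Rightarrow> 'b \<Rightarrow> real" where
  "chi u x \<xi> = (if u x \<bullet> \<xi> > 0 then 1 else 0)"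

definition kinetic_formulation :: "'a::euclidean_space set \<Rightarrow> ('a \<Rightarrow> 'a) \<Rightarrow> bool" where
  "kinetic_formulation \<Omega> u \<longleftrightarrow>
     (\<forall>\<xi>\<in>sphere 0 1. \<forall>v. v \<bullet> \<xi> = 0 \<longrightarrow>
        (\<forall>\<phi>\<in>test_functions \<Omega>. distr_dir_deriv \<Omega> v (\<lambda>x. chi u x \<xi>) \<phi> = 0))"

text \<open>The value at the origin is the irrelevant \<open>0\<close>.\<close>

definition vortex :: "'a::euclidean_space \<Rightarrow> 'a" where
  "vortex x = x /\<^sub>R norm x"

end

theory Submission
  imports Defs "HOL-Real_Asymp.Real_Asymp"
begin

text \<open>
  The theorem reduces to linear algebra for pairs and triples of points in general position.

  Let $B \<subseteq> \<Omega>$ be a ball. For a fixed direction $\<xi>$ the kinetic equation says that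
  $\<chi>(\<cdot>,\<xi>)$ is invariant in $B$ under translations orthogonal to $\<xi>$
  (\<open>chi_segment_invariant\<close>). Consequently, for almost all pairs $x, y \<in> B$, the half-spaces
  $\{\<xi> : u(x)\<cdot>\<xi> > 0\}$ and $\{\<xi> : u(y)\<cdot>\<xi> > 0\}$ have the same trace on the
  hyperplane orthogonal to $x - y$. So the projections of $u(x)$ and $u(y)$ to this hyperplane are
  positive multiples of each other:
  $u(x) - \<kappa> u(y) = \<mu> (x - y)$ with $\<kappa> > 0$ (\<open>AE_pairs_coplanar\<close>).

  Geometrically, the lines $x + \<real> u(x)$ and $y + \<real> u(y)$ are coplanar. If $u$ is not almost
  everywhere constant in $B$, two of these lines meet in a single point $P$. In dimension
  $N \<ge> 3$ almost every third point lies outside the plane of these two lines, and a line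
  through it that is coplanar with both must contain $P$ (\<open>third_line_through_intersection\<close>).
  Since $\<kappa> > 0$, the orientation towards or away from $P$ is the same for all lines. Hence $u$ is
  constant or a vortex field with a sign in $B$ (\<open>const_or_vortex_if_coplanar\<close>).

  Two different fields of this kind agree only on a null set, so the local descriptions
  on overlapping balls coincide, and by connectedness a single one holds in $\<Omega>$
  (\<open>AE_glue_connected\<close>). As $u$ is not constant, it is a vortex.
\<close>

section \<open>Closure properties of the smooth functions\<close>

lemma cont_diff_continuous: "cont_diff k f \<Longrightarrow> continuous_on UNIV f"
  by (cases k) (auto intro!: differentiable_imp_continuous_on simp: differentiable_on_def differentiable_at_withinI)

lemma cont_diff_Suc_imp: "cont_diff (Suc k) f \<Longrightarrow> cont_diff k f"
proof (induction k arbitrary: f)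
  case 0
  then show ?case by (metis cont_diff_continuous cont_diff.simps(1))
next
  case (Suc k)
  then show ?case by (subst cont_diff.simps) (metis cont_diff.simps(2))
qed

lemma cont_diff_const: "cont_diff k (\<lambda>x. c)"
  by (induction k arbitrary: c) (auto simp: frechet_derivative_const)

lemma cont_diff_SucI:
  assumes "\<And>x. (f has_derivative f' x) (at x)" "\<And>v. cont_diff k (\<lambda>x. f' x v)"
  shows "cont_diff (Suc k) f"
proof -
  have "frechet_derivative f (at x) = f' x" for x
    using frechet_derivative_at[OF assms(1)] by simp
  then show ?thesis
    using assms unfolding cont_diff.simps by (auto simp: differentiable_def)
qed

lemma cont_diff_SucD:
  assumes "cont_diff (Suc k) f"
  shows "(f has_derivative frechet_derivative f (at x)) (at x)"
    and "cont_diff k (\<lambda>x. frechet_derivative f (at x) v)"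
  using assms by (auto simp: frechet_derivative_works)

lemma cont_diff_add:
  "cont_diff k f \<Longrightarrow> cont_diff k g \<Longrightarrow> cont_diff k (\<lambda>x. f x + g x)"
proof (induction k arbitrary: f g)
  case 0
  then show ?case by (auto intro: continuous_intros)
next
  case (Suc k)
  show ?case
    by (rule cont_diff_SucI[OF has_derivative_add[OF cont_diff_SucD(1) cont_diff_SucD(1)]])
       (use Suc in auto)
qed

lemma cont_diff_mult:
  "cont_diff k f \<Longrightarrow> cont_diff k g \<Longrightarrow> cont_diff k (\<lambda>x. f x * g x)"
proof (induction k arbitrary: f g)
  case 0
  then show ?case by (auto intro: continuous_intros)
next
  case (Suc k)
  note D = cont_diff_SucD[OF Suc.prems(1)] cont_diff_SucD[OF Suc.prems(2)]
  show ?case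
    by (rule cont_diff_SucI[OF has_derivative_mult[OF D(1) D(3)]])
       (intro cont_diff_add Suc.IH D(2,4) cont_diff_Suc_imp[OF Suc.prems(1)]
         cont_diff_Suc_imp[OF Suc.prems(2)])
qed

lemma cont_diff_prod:
  assumes "\<And>i. i \<in> I \<Longrightarrow> cont_diff k (f i)"
  shows "cont_diff k (\<lambda>x. \<Prod>i\<in>I. f i x)"
  using assms by (induction I rule: infinite_finite_induct) (auto intro: cont_diff_const cont_diff_mult)

lemma has_derivative_translate:
  assumes "cont_diff (Suc k) f"
  shows "((\<lambda>x. f (x - c)) has_derivative frechet_derivative f (at (x - c))) (at x)"
  by (rule has_derivative_compose[of "\<lambda>x. x - c" "\<lambda>h. h" x UNIV, OF _ cont_diff_SucD(1)[OF assms]])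
     (auto intro!: derivative_eq_intros)

lemma frechet_derivative_translate:
  assumes "cont_diff (Suc k) f"
  shows "frechet_derivative (\<lambda>x. f (x - c)) (at x) = frechet_derivative f (at (x - c))"
  using frechet_derivative_at[OF has_derivative_translate[OF assms]] by simp

lemma cont_diff_translate: "cont_diff k f \<Longrightarrow> cont_diff k (\<lambda>x. f (x - c))"
proof (induction k arbitrary: f)
  case 0
  then show ?case by (auto intro!: continuous_on_compose2[of UNIV f] continuous_intros)
next
  case (Suc k)
  show ?case
    by (rule cont_diff_SucI[OF has_derivative_translate[OF Suc.prems]]) (use Suc in auto)
qed

text \<open>The induction has to treat all derivatives of the profile at once, because each partial derivative
of a ridge function is a multiple of the ridge function of the next derivative; hence the profile is
given by the whole sequence \<open>h\<close> of its derivatives.\<close>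

lemma cont_diff_ridge:
  fixes h :: "nat \<Rightarrow> real \<Rightarrow> real"
  assumes "\<And>n t. (h n has_real_derivative h (Suc n) t) (at t)"
  shows "cont_diff k (\<lambda>x. h n (x \<bullet> b + c))"
proof (induction k arbitrary: n)
  case 0
  have "continuous_on UNIV (h n)"
    using assms DERIV_isCont by (blast intro: continuous_at_imp_continuous_on)
  then show ?case
    by (auto intro!: continuous_on_compose2[of UNIV "h n"] continuous_intros)
next
  case (Suc k)
  have "((\<lambda>x. h n (x \<bullet> b + c)) has_derivative (\<lambda>v. h (Suc n) (x \<bullet> b + c) * (v \<bullet> b))) (at x)" for x
    by (rule has_derivative_eq_rhs[OF DERIV_compose_FDERIV[OF assms]])
       (auto intro!: derivative_eq_intros)
  then show ?case
    by (rule cont_diff_SucI) (intro cont_diff_mult cont_diff_const Suc)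
qed


section \<open>Smooth bump functions on boxes\<close>

text \<open>The classical function $e^{-c/t}$, extended by zero to $t \<le> 0$, is multiplied by a polynomial in
\<open>1 / t\<close>: the class of these products is closed under differentiation. The parameter \<open>c\<close> is kept
because the function tends to the indicator of $t > 0$ as \<open>c\<close> tends to zero.\<close>

definition flat_exp :: "real \<Rightarrow> real poly \<Rightarrow> real \<Rightarrow> real" where
  "flat_exp c p t = (if t > 0 then poly p (1 / t) * exp (- c / t) else 0)"

lemma poly_times_exp_tendsto_0:
  assumes "c > (0::real)"
  shows "((\<lambda>s. poly p s * exp (- c * s)) \<longlongrightarrow> 0) at_top"
proof -
  have "((\<lambda>s::real. s ^ i * exp (- c * s)) \<longlongrightarrow> 0) at_top" for i
    using assms by real_asymp
  then have "((\<lambda>s. \<Sum>i\<le>degree p. coeff p i * (s ^ i * exp (- c * s))) \<longlongrightarrow> (\<Sum>i\<le>degree p. coeff p i * 0)) at_top"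
    by (intro tendsto_intros)
  then show ?thesis
    by (simp add: poly_altdef sum_distrib_right mult.assoc)
qed

lemma flat_exp_tendsto_0:
  assumes "c > 0"
  shows "(flat_exp c p \<longlongrightarrow> 0) (at 0)"
proof -
  have "((\<lambda>t. poly p (inverse t) * exp (- c * inverse t)) \<longlongrightarrow> 0) (at_right 0)"
    using filterlim_compose[OF poly_times_exp_tendsto_0[OF assms] filterlim_inverse_at_top_right] .
  then have "(flat_exp c p \<longlongrightarrow> 0) (at_right 0)"
    by (rule Lim_transform_eventually)
       (auto simp: flat_exp_def eventually_at_filter divide_inverse)
  moreover have "(flat_exp c p \<longlongrightarrow> 0) (at_left 0)"
    by (rule Lim_transform_eventually[OF tendsto_const])
       (auto simp: flat_exp_def eventually_at_filter)
  ultimately show ?thesis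
    by (simp add: filterlim_at_split)
qed

text \<open>For $t > 0$ this is the product rule, since \<open>1 / t\<close> has the derivative $-(1/t)^2$. At the origin
the difference quotient is again of the form \<open>flat_exp\<close>, with one more factor \<open>1 / t\<close>, and tends to
zero because the exponential beats every polynomial.\<close>

lemma flat_exp_has_derivative:
  assumes "c > 0"
  shows "(flat_exp c p has_real_derivative
           flat_exp c (monom 1 2 * (smult c p - pderiv p)) t) (at t)"
proof -
  consider "t > 0" | "t < 0" | "t = 0" by linarith
  then show ?thesis
  proof cases
    case 1
    have "((\<lambda>t. poly p (1 / t) * exp (- c / t)) has_real_derivative
           flat_exp c (monom 1 2 * (smult c p - pderiv p)) t) (at t)"
      using 1 by (auto intro!: derivative_eq_intros DERIV_chain2[OF poly_DERIV]
          simp: flat_exp_def poly_monom field_simps power2_eq_square)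
    then show ?thesis
      by (rule has_field_derivative_transform_within_open[of _ _ _ "{0<..}"])
         (use 1 in \<open>auto simp: flat_exp_def\<close>)
  next
    case 2
    have "((\<lambda>t. 0) has_real_derivative flat_exp c (monom 1 2 * (smult c p - pderiv p)) t) (at t)"
      using 2 by (auto simp: flat_exp_def)
    then show ?thesis
      by (rule has_field_derivative_transform_within_open[of _ _ _ "{..<0}"])
         (use 2 in \<open>auto simp: flat_exp_def\<close>)
  next
    case 3
    have "(flat_exp c (pCons 0 p) \<longlongrightarrow> 0) (at 0)"
      by (rule flat_exp_tendsto_0[OF assms])
    then have "((\<lambda>t. flat_exp c p t / t) \<longlongrightarrow> 0) (at 0)"
      by (rule Lim_transform_eventually) (auto simp: flat_exp_def eventually_at_filter)
    then show ?thesis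
      using 3 by (simp add: has_field_derivative_iff flat_exp_def)
  qed
qed

lemma cont_diff_flat_exp:
  assumes "c > 0"
  shows "cont_diff k (\<lambda>x. flat_exp c p (x \<bullet> b + d))"
  using cont_diff_ridge[of "\<lambda>n. flat_exp c (((\<lambda>p. monom 1 2 * (smult c p - pderiv p)) ^^ n) p)" k 0 b d]
    flat_exp_has_derivative[OF assms] by simp

text \<open>The second factor is written with \<open>- i\<close> so that both are ridge functions in the sense of
\<open>cont_diff_ridge\<close>.\<close>

definition box_bump :: "real \<Rightarrow> 'a::euclidean_space \<Rightarrow> 'a \<Rightarrow> 'a \<Rightarrow> real" where
  "box_bump c a b x =
     (\<Prod>i\<in>Basis. flat_exp c 1 (x \<bullet> i + - (a \<bullet> i)) * flat_exp c 1 (x \<bullet> - i + b \<bullet> i))"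

lemma cont_diff_box_bump: "c > 0 \<Longrightarrow> cont_diff k (box_bump c a b)"
  unfolding box_bump_def [abs_def]
  by (intro cont_diff_prod cont_diff_mult cont_diff_flat_exp)

lemma flat_exp_1_nonzero_iff: "flat_exp c 1 t \<noteq> 0 \<longleftrightarrow> t > 0"
  by (simp add: flat_exp_def)

lemma box_bump_nonzero_iff: "box_bump c a b x \<noteq> 0 \<longleftrightarrow> x \<in> box a b"
  by (simp add: box_bump_def flat_exp_1_nonzero_iff mem_box)

lemma closure_box_bump_support: "closure {x. box_bump c a b x \<noteq> 0} \<subseteq> cbox a b"
  unfolding box_bump_nonzero_iff Collect_mem_eq
  by (intro closure_minimal box_subset_cbox closed_cbox)

lemma box_bump_bounds:
  assumes "c > 0"
  shows "0 \<le> box_bump c a b x" "box_bump c a b x \<le> 1"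
proof -
  have "0 \<le> flat_exp c 1 t" "flat_exp c 1 t \<le> 1" for t
    using assms by (auto simp: flat_exp_def)
  then show "0 \<le> box_bump c a b x" "box_bump c a b x \<le> 1"
    unfolding box_bump_def by (auto intro!: prod_nonneg prod_le_1 mult_le_one)
qed

lemma box_bump_tendsto_indicator:
  "(\<lambda>n. box_bump (1 / real (Suc n)) a b x) \<longlonglongrightarrow> indicator (box a b) x"
proof (cases "x \<in> box a b")
  case True
  have "(\<lambda>n. flat_exp (1 / real (Suc n)) 1 t) \<longlonglongrightarrow> 1" if "t > 0" for t
    using that unfolding flat_exp_def by simp real_asymp
  then have "(\<lambda>n. box_bump (1 / real (Suc n)) a b x) \<longlonglongrightarrow> (\<Prod>i\<in>(Basis::'a set). 1 * 1)"
    unfolding box_bump_def using True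
    by (intro tendsto_intros) (auto simp: mem_box)
  then show ?thesis using True by simp
next
  case False
  then have "box_bump (1 / real (Suc n)) a b x = 0" for n
    using box_bump_nonzero_iff by blast
  then show ?thesis using False by simp
qed

lemma box_bump_test_function:
  assumes "c > 0" "cbox a b \<subseteq> \<Omega>"
  shows "box_bump c a b \<in> test_functions \<Omega>"
proof -
  have "compact (closure {x. box_bump c a b x \<noteq> 0})"
    by (simp add: box_bump_nonzero_iff compact_closure)
  then show ?thesis
    using assms cont_diff_box_bump closure_box_bump_support unfolding test_functions_def by blast
qed

section \<open>From a vanishing directional derivative to translation invariance\<close>

lemma frechet_derivative_zero_off_support:
  assumes "cont_diff (Suc 0) \<phi>" "x \<notin> closure {x. \<phi> x \<noteq> (0::real)}"
  shows "frechet_derivative \<phi> (at x) v = 0"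
proof -
  have "(\<phi> has_derivative (\<lambda>v. 0)) (at x)"
  proof (rule has_derivative_transform_within_open[OF has_derivative_const])
    show "open (- closure {x. \<phi> x \<noteq> 0})" by (intro open_Compl closed_closure)
    show "x \<in> - closure {x. \<phi> x \<noteq> 0}" using assms by simp
  next
    fix y assume "y \<in> - closure {x. \<phi> x \<noteq> 0}"
    then show "0 = \<phi> y" using closure_subset[of "{x. \<phi> x \<noteq> 0}"] by auto
  qed
  from frechet_derivative_at[OF this] show ?thesis by metis
qed

lemma integral_along_segment:
  fixes \<phi> :: "'a::euclidean_space \<Rightarrow> real"
  assumes "cont_diff (Suc 0) \<phi>"
  shows "(\<integral>t. frechet_derivative \<phi> (at (x - t *\<^sub>R w)) w * indicator {0..1} t \<partial>lborel)
           = \<phi> x - \<phi> (x - w)"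
proof -
  let ?D = "\<lambda>x. frechet_derivative \<phi> (at x) w"
  have "continuous_on UNIV ?D"
    using assms by simp
  then have "continuous_on UNIV (\<lambda>t. ?D (x - t *\<^sub>R w))"
    by (rule continuous_on_compose2) (auto intro!: continuous_intros)
  then have cont: "isCont (\<lambda>t. ?D (x - t *\<^sub>R w)) t" for t
    by (simp add: continuous_on_eq_continuous_at)
  have "((\<lambda>t. - \<phi> (x - t *\<^sub>R w)) has_real_derivative ?D (x - t *\<^sub>R w)) (at t)" for t
  proof -
    have lin: "linear (frechet_derivative \<phi> (at y))" for y
      using cont_diff_SucD(1)[OF assms] by (rule has_derivative_linear)
    have "((\<lambda>t. \<phi> (x - t *\<^sub>R w)) has_derivative
            (\<lambda>h. frechet_derivative \<phi> (at (x - t *\<^sub>R w)) (- (h *\<^sub>R w)))) (at t)"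
      by (rule has_derivative_compose[of "\<lambda>t. x - t *\<^sub>R w" "\<lambda>h. - (h *\<^sub>R w)" t UNIV \<phi>,
            OF _ cont_diff_SucD(1)[OF assms]]) (auto intro!: derivative_eq_intros)
    then have "((\<lambda>t. \<phi> (x - t *\<^sub>R w)) has_derivative (\<lambda>h. - ?D (x - t *\<^sub>R w) * h)) (at t)"
      by (simp add: linear_neg[OF lin] linear_cmul[OF lin] mult.commute)
    then have "((\<lambda>t. \<phi> (x - t *\<^sub>R w)) has_real_derivative - ?D (x - t *\<^sub>R w)) (at t)"
      unfolding has_field_derivative_def .
    from DERIV_minus[OF this] show ?thesis by simp
  qed
  from integral_FTC_Icc_real[OF _ this cont, of 0 1] show ?thesis by simp
qed

text \<open>The distributional equation becomes invariance under a finite translation: by the fundamental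
theorem of calculus along the segment, $\<phi>(x) - \<phi>(x - w)$ is the integral over $t$ of the derivative
of $\<phi>$ in direction \<open>w\<close> at $x - t w$, and Fubini's theorem lets one integrate against \<open>f\<close> first.\<close>

lemma integral_translate_eq:
  fixes f \<phi> :: "'a::euclidean_space \<Rightarrow> real"
  assumes [measurable]: "f \<in> borel_measurable borel" and f: "\<And>x. \<bar>f x\<bar> \<le> 1"
    and \<phi>: "cont_diff (Suc 0) \<phi>" and K: "compact (closure {x. \<phi> x \<noteq> 0})"
    and zero: "\<And>t. t \<in> {0..1} \<Longrightarrow>
      (\<integral>x. f x * frechet_derivative \<phi> (at (x - t *\<^sub>R w)) w \<partial>lborel) = 0"
  shows "(\<integral>x. f x * \<phi> (x - w) \<partial>lborel) = (\<integral>x. f x * \<phi> x \<partial>lborel)"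
proof -
  define K where "K = closure {x. \<phi> x \<noteq> 0}"
  define D where "D = (\<lambda>x. frechet_derivative \<phi> (at x) w)"
  have cK: "compact K" using K by (simp add: K_def)
  have contD: "continuous_on UNIV D" and cont\<phi>: "continuous_on UNIV \<phi>"
    using \<phi> cont_diff_continuous[OF \<phi>] by (auto simp: D_def)
  have [measurable]: "D \<in> borel_measurable borel" "\<phi> \<in> borel_measurable borel"
    using contD cont\<phi> by (auto intro: borel_measurable_continuous_onI)
  have supp: "D x = 0" "\<phi> x = 0" if "x \<notin> K" for x
  proof -
    show "D x = 0"
      using frechet_derivative_zero_off_support[OF \<phi>] that by (simp add: K_def D_def)
    show "\<phi> x = 0"
      using that closure_subset[of "{x. \<phi> x \<noteq> 0}"] unfolding K_def by blast
  qed
  have "bounded ((\<lambda>x. (D x, \<phi> x)) ` K)"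
    by (intro compact_imp_bounded compact_continuous_image continuous_intros cK
          continuous_on_subset[OF contD] continuous_on_subset[OF cont\<phi>]) auto
  then obtain M where M: "\<And>x. x \<in> K \<Longrightarrow> norm (D x, \<phi> x) \<le> M"
    by (auto simp: bounded_iff)
  have M': "\<bar>D x\<bar> \<le> \<bar>M\<bar> \<and> \<bar>\<phi> x\<bar> \<le> \<bar>M\<bar>" for x
  proof (cases "x \<in> K")
    case True
    from M[OF this] norm_fst_le[of "D x" "\<phi> x"] norm_snd_le[of "\<phi> x" "D x"]
    show ?thesis unfolding real_norm_def by linarith
  qed (simp add: supp)
  have "compact ((\<lambda>(t, y). y + t *\<^sub>R w) ` ({0..1::real} \<times> K))"
    unfolding case_prod_beta
    by (intro compact_continuous_image compact_Times cK continuous_intros) auto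
  then obtain c where "(\<lambda>(t, y). y + t *\<^sub>R w) ` ({0..1::real} \<times> K) \<subseteq> cbox (-c) c"
    using bounded_subset_cbox_symmetric compact_imp_bounded by metis
  then have "y + t *\<^sub>R w \<in> cbox (-c) c" if "t \<in> {0..1}" "y \<in> K" for t y
    using that by force
  note image_box = this
  have C: "x \<in> cbox (-c) c" if "t \<in> {0..1}" "x - t *\<^sub>R w \<in> K" for x t
    using image_box[OF that] by simp
  \<comment> \<open>The supports of all translates lie in \<open>cbox (- c) c\<close>, so \<open>F\<close> is dominated by a multiple of its indicator.\<close>
  define F where "F = (\<lambda>t x. f x * (D (x - t *\<^sub>R w) * indicator {0..1::real} t))"
  have int: "integrable (lborel \<Otimes>\<^sub>M lborel) (case_prod F)"
  proof (rule Bochner_Integration.integrable_bound)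
    show "integrable (lborel \<Otimes>\<^sub>M lborel)
        (\<lambda>p. \<bar>M\<bar> * indicator (cbox (0::real, -c) (1, c)) p)"
      unfolding lborel_prod
      by (intro integrable_mult_right integrable_real_indicator emeasure_lborel_cbox_finite) simp
    show "case_prod F \<in> borel_measurable (lborel \<Otimes>\<^sub>M lborel)"
      unfolding F_def case_prod_beta by measurable
    have "norm (F t x) \<le> norm (\<bar>M\<bar> * indicator (cbox (0, - c) (1, c)) (t, x))" for t x
    proof (cases "t \<in> {0..1} \<and> x - t *\<^sub>R w \<in> K")
      case True
      then have "(t, x) \<in> cbox (0, -c) (1, c)"
        using C by (auto simp: cbox_Pair_eq)
      moreover have "\<bar>f x\<bar> * \<bar>D (x - t *\<^sub>R w)\<bar> \<le> 1 * \<bar>M\<bar>"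
        by (intro mult_mono f M'[THEN conjunct1] M'[THEN conjunct2]) auto
      ultimately show ?thesis using True by (simp add: F_def abs_mult)
    qed (auto simp: F_def supp)
    then show "AE p in lborel \<Otimes>\<^sub>M lborel. norm (case_prod F p)
        \<le> norm (\<bar>M\<bar> * indicator (cbox (0, - c) (1, c)) p)"
      by auto
  qed
  have intf: "integrable lborel (\<lambda>x. f x * \<phi> (x - t *\<^sub>R w))" if "t \<in> {0..1}" for t
  proof (rule Bochner_Integration.integrable_bound)
    show "integrable lborel (\<lambda>x. \<bar>M\<bar> * indicator (cbox (-c) c) x)"
      by (intro integrable_mult_right integrable_real_indicator emeasure_lborel_cbox_finite) simp
    have "norm (f x * \<phi> (x - t *\<^sub>R w)) \<le> norm (\<bar>M\<bar> * indicator (cbox (- c) c) x)" for x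
    proof (cases "x - t *\<^sub>R w \<in> K")
      case True
      moreover have "\<bar>f x\<bar> * \<bar>\<phi> (x - t *\<^sub>R w)\<bar> \<le> 1 * \<bar>M\<bar>"
        by (intro mult_mono f M'[THEN conjunct1] M'[THEN conjunct2]) auto
      ultimately show ?thesis using C[OF that] by (simp add: abs_mult)
    qed (auto simp: supp)
    then show "AE x in lborel. norm (f x * \<phi> (x - t *\<^sub>R w)) \<le> norm (\<bar>M\<bar> * indicator (cbox (- c) c) x)"
      by auto
  qed measurable
  have "(\<integral>x. f x * \<phi> x \<partial>lborel) - (\<integral>x. f x * \<phi> (x - w) \<partial>lborel)
      = (\<integral>x. f x * \<phi> x - f x * \<phi> (x - w) \<partial>lborel)"
    using intf[of 0] intf[of 1] by (intro Bochner_Integration.integral_diff[symmetric]) auto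
  also have "\<dots> = (\<integral>x. (\<integral>t. F t x \<partial>lborel) \<partial>lborel)"
    unfolding F_def D_def
    by (simp add: integral_along_segment[OF \<phi>] right_diff_distrib del: One_nat_def)
  also have "\<dots> = (\<integral>t. (\<integral>x. F t x \<partial>lborel) \<partial>lborel)"
    by (rule lborel_pair.Fubini_integral[OF int])
  also have "\<dots> = (\<integral>t. 0 \<partial>(lborel::real measure))"
  proof (rule Bochner_Integration.integral_cong)
    fix t :: real
    have "(\<integral>x. F t x \<partial>lborel) = indicator {0..1} t * (\<integral>x. f x * D (x - t *\<^sub>R w) \<partial>lborel)"
      by (simp add: F_def indicator_def)
    also have "\<dots> = 0"
      using zero[of t] by (auto simp: D_def indicator_def)
    finally show "(\<integral>x. F t x \<partial>lborel) = 0" .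
  qed simp
  finally show ?thesis by simp
qed

lemma test_function_translate:
  assumes "\<phi> \<in> test_functions UNIV" "\<And>x. x \<in> closure {x. \<phi> x \<noteq> 0} \<Longrightarrow> x + c \<in> \<Omega>"
  shows "(\<lambda>x. \<phi> (x - c)) \<in> test_functions \<Omega>"
proof -
  have "{x. \<phi> (x - c) \<noteq> 0} = (+) c ` {x. \<phi> x \<noteq> 0}"
  proof (intro set_eqI iffI)
    fix x assume "x \<in> {x. \<phi> (x - c) \<noteq> 0}"
    then show "x \<in> (+) c ` {x. \<phi> x \<noteq> 0}"
      by (intro image_eqI[of _ _ "x - c"]) auto
  qed auto
  then have "closure {x. \<phi> (x - c) \<noteq> 0} = (+) c ` closure {x. \<phi> x \<noteq> 0}"
    by (simp add: closure_translation)
  moreover have "compact ((+) c ` closure {x. \<phi> x \<noteq> 0})"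
    using assms by (intro compact_translation) (simp add: test_functions_def)
  ultimately show ?thesis
    using assms unfolding test_functions_def
    by (intro CollectI conjI) (auto simp: cont_diff_translate add.commute)
qed

section \<open>Localisation by bump functions\<close>

lemma AE_lborel_negligible:
  fixes N :: "'a::euclidean_space set"
  assumes "negligible N"
  shows "AE x in lborel. x \<notin> N"
  using AE_not_in[of N lebesgue] assms by (simp add: negligible_iff_null_sets AE_completion_iff)

text \<open>Open boxes form a generator of the Borel sets that is stable under intersection, so the measures
with densities \<open>f\<close> and \<open>g\<close>, restricted to a box inside \<open>U\<close>, coincide and have the same density.
Countably many boxes cover \<open>U\<close>.\<close>

lemma AE_eq_if_box_integrals_eq:
  fixes f g :: "'a::euclidean_space \<Rightarrow> ennreal"
  assumes [measurable]: "f \<in> borel_measurable borel" "g \<in> borel_measurable borel"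
    and U: "open U"
    and fin: "\<And>a b. cbox a b \<subseteq> U \<Longrightarrow> (\<integral>\<^sup>+x\<in>box a b. f x \<partial>lborel) < \<infinity>"
    and eq: "\<And>a b. cbox a b \<subseteq> U \<Longrightarrow>
        (\<integral>\<^sup>+x\<in>box a b. f x \<partial>lborel) = (\<integral>\<^sup>+x\<in>box a b. g x \<partial>lborel)"
  shows "AE x in lborel. x \<in> U \<longrightarrow> f x = g x"
proof -
  have box: "AE x in lborel. x \<in> cbox c d \<longrightarrow> f x = g x" if cd: "cbox c d \<subseteq> U" for c d
  proof -
    let ?f = "\<lambda>x. f x * indicator (box c d) x" and ?g = "\<lambda>x. g x * indicator (box c d) x"
    let ?E = "range (\<lambda>(a, b). box a b :: 'a set)"
    let ?A = "\<lambda>n::nat. box (- (real n *\<^sub>R One)) (real n *\<^sub>R One) :: 'a set"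
    have "density lborel ?f = density lborel ?g"
    proof (rule measure_eqI_generator_eq)
      show "Int_stable ?E"
        by (auto simp: Int_stable_def box_Int_box)
      show "?E \<subseteq> Pow UNIV" "sets (density lborel ?f) = sigma_sets UNIV ?E"
        "sets (density lborel ?g) = sigma_sets UNIV ?E"
        by (simp_all add: borel_eq_box)
      show "range ?A \<subseteq> ?E" "(\<Union>i. ?A i) = UNIV"
        unfolding UN_box_eq_UNIV by auto
      have em: "emeasure (density lborel (\<lambda>x. h x * indicator (box c d) x)) (box a b) =
          (\<integral>\<^sup>+x\<in>box a b \<inter> box c d. h x \<partial>lborel)" if [measurable]: "h \<in> borel_measurable borel" for h a b
        by (subst emeasure_density) (auto intro!: nn_integral_cong simp: indicator_def)
      have sub: "\<exists>p q. box a b \<inter> box c d = box p q \<and> cbox p q \<subseteq> U" for a b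
      proof -
        obtain p q where pq: "box a b \<inter> box c d = box p q"
          by (auto simp: box_Int_box)
        show ?thesis
        proof (cases "box p q = {}")
          case True
          \<comment> \<open>When the intersection is empty, \<open>cbox p q\<close> may leave \<open>U\<close>; \<open>cbox One 0\<close> is empty as well.\<close>
          moreover have "cbox One (0::'a) = {}" "box One (0::'a) = {}"
            using nonempty_Basis by (auto simp: box_eq_empty ex_in_conv)
          ultimately show ?thesis using pq by (intro exI[of _ One] exI[of _ 0]) simp
        next
          case False
          have "closure (box p q) \<subseteq> cbox c d"
            using pq box_subset_cbox[of c d] by (intro closure_minimal) auto
          then have "cbox p q \<subseteq> U" using False cd by auto
          with pq show ?thesis by blast
        qed
      qed
      show "emeasure (density lborel ?f) X = emeasure (density lborel ?g) X" if X: "X \<in> ?E" for X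
      proof -
        obtain a b where "X = box a b" using X by auto
        moreover obtain p q where "box a b \<inter> box c d = box p q" "cbox p q \<subseteq> U" using sub by blast
        ultimately show ?thesis using eq by (simp add: em)
      qed
      show "emeasure (density lborel ?f) (?A i) \<noteq> \<infinity>" for i
      proof -
        obtain p q where "?A i \<inter> box c d = box p q" "cbox p q \<subseteq> U" using sub by blast
        then show ?thesis using fin[of p q] by (simp add: em)
      qed
    qed
    then have "AE x in lborel. ?f x = ?g x"
      by (intro sigma_finite_measure.density_unique[OF sigma_finite_lborel]) auto
    moreover have "AE x in lborel. x \<notin> cbox c d - box c d"
      by (rule AE_lborel_negligible[OF negligible_frontier_interval])
    ultimately show ?thesis
      by eventually_elim (auto simp: indicator_def split: if_splits)
  qed
  obtain \<D> where "countable \<D>" "\<And>X. X \<in> \<D> \<Longrightarrow> \<exists>a b. X = cbox a b" "\<Union>\<D> = U"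
    using open_countable_Union_open_cbox[OF U] by metis
  have "AE x in lborel. \<forall>X\<in>\<D>. x \<in> X \<longrightarrow> f x = g x"
  proof (subst AE_ball_countable[OF \<open>countable \<D>\<close>], intro ballI)
    fix X assume "X \<in> \<D>"
    then obtain a b where "X = cbox a b" "cbox a b \<subseteq> U"
      using \<open>\<And>X. X \<in> \<D> \<Longrightarrow> \<exists>a b. X = cbox a b\<close> \<open>\<Union>\<D> = U\<close> by blast
    then show "AE x in lborel. x \<in> X \<longrightarrow> f x = g x" using box by simp
  qed
  then show ?thesis
    by eventually_elim (use \<open>\<Union>\<D> = U\<close> in auto)
qed

lemma AE_eq_if_bump_integrals_eq:
  fixes f g :: "'a::euclidean_space \<Rightarrow> real"
  assumes [measurable]: "f \<in> borel_measurable borel" "g \<in> borel_measurable borel"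
    and f: "\<And>x. f x \<in> {0..1}" and g: "\<And>x. g x \<in> {0..1}" and U: "open U"
    and eq: "\<And>a b c. cbox a b \<subseteq> U \<Longrightarrow> c > 0 \<Longrightarrow>
        (\<integral>x. f x * box_bump c a b x \<partial>lborel) = (\<integral>x. g x * box_bump c a b x \<partial>lborel)"
  shows "AE x in lborel. x \<in> U \<longrightarrow> f x = g x"
proof -
  have int: "integrable lborel (\<lambda>x. h x * indicator (box a b) x)"
    if [measurable]: "h \<in> borel_measurable borel" and h: "\<And>x. h x \<in> {0..1::real}" for h and a b :: 'a
  proof (rule Bochner_Integration.integrable_bound)
    show "integrable lborel (indicator (box a b) :: 'a \<Rightarrow> real)"
      by (intro integrable_real_indicator emeasure_lborel_box_finite) simp
    show "AE x in lborel. norm (h x * indicator (box a b) x) \<le> norm (indicator (box a b) x :: real)"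
      using h by (auto simp: indicator_def)
  qed simp
  have lim: "(\<lambda>n. \<integral>x. h x * box_bump (1 / real (Suc n)) a b x \<partial>lborel)
      \<longlonglongrightarrow> (\<integral>x. h x * indicator (box a b) x \<partial>lborel)"
    if [measurable]: "h \<in> borel_measurable borel" and h: "\<And>x. h x \<in> {0..1::real}" for h and a b :: 'a
  proof (rule integral_dominated_convergence[where w = "indicator (box a b)"])
    have [measurable]: "box_bump (1 / real (Suc n)) a b \<in> borel_measurable borel" for n
      by (intro borel_measurable_continuous_onI cont_diff_continuous[of 0] cont_diff_box_bump) simp
    show "(\<lambda>x. h x * box_bump (1 / real (Suc n)) a b x) \<in> borel_measurable lborel" for n
      by measurable
    show "integrable lborel (indicator (box a b) :: 'a \<Rightarrow> real)"
      by (intro integrable_real_indicator emeasure_lborel_box_finite) simp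
    show "AE x in lborel. (\<lambda>n. h x * box_bump (1 / real (Suc n)) a b x)
        \<longlonglongrightarrow> h x * indicator (box a b) x"
      by (intro AE_I2 tendsto_intros box_bump_tendsto_indicator)
    show "AE x in lborel. norm (h x * box_bump (1 / real (Suc n)) a b x) \<le> indicator (box a b) x" for n
    proof (intro AE_I2)
      fix x :: 'a
      let ?b = "box_bump (1 / real (Suc n)) a b x"
      show "norm (h x * ?b) \<le> indicator (box a b) x"
      proof (cases "x \<in> box a b")
        case True
        have "\<bar>h x\<bar> * \<bar>?b\<bar> \<le> 1 * 1"
          using h[of x] box_bump_bounds[of "1 / real (Suc n)" a b x] by (intro mult_mono) auto
        then show ?thesis using True by (simp add: abs_mult)
      next
        case False
        then have "?b = 0" using box_bump_nonzero_iff by blast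
        then show ?thesis by simp
      qed
    qed
  qed measurable
  have "AE x in lborel. x \<in> U \<longrightarrow> ennreal (f x) = ennreal (g x)"
  proof (rule AE_eq_if_box_integrals_eq[OF _ _ U])
    have nn: "(\<integral>\<^sup>+x\<in>box a b. ennreal (h x) \<partial>lborel) = ennreal (\<integral>x. h x * indicator (box a b) x \<partial>lborel)"
      if [measurable]: "h \<in> borel_measurable borel" and h: "\<And>x. h x \<in> {0..1::real}" for h and a b :: 'a
    proof (subst nn_integral_eq_integral[symmetric])
      show "integrable lborel (\<lambda>x. h x * indicator (box a b) x)" using that by (rule int)
      show "AE x in lborel. 0 \<le> h x * indicator (box a b) x" using h by auto
      show "(\<integral>\<^sup>+x\<in>box a b. ennreal (h x) \<partial>lborel) = (\<integral>\<^sup>+x. ennreal (h x * indicator (box a b) x) \<partial>lborel)"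
        by (intro nn_integral_cong) (auto simp: indicator_def)
    qed
    fix a b :: 'a assume ab: "cbox a b \<subseteq> U"
    show "(\<integral>\<^sup>+x\<in>box a b. ennreal (f x) \<partial>lborel) < \<infinity>"
      by (subst nn[OF assms(1) f]) simp
    have "(\<integral>x. f x * indicator (box a b) x \<partial>lborel) = (\<integral>x. g x * indicator (box a b) x \<partial>lborel)"
      using lim[of f a b] lim[of g a b] eq[OF ab] f g
      by (intro LIMSEQ_unique[OF lim[of f a b]]) auto
    then show "(\<integral>\<^sup>+x\<in>box a b. ennreal (f x) \<partial>lborel) = (\<integral>\<^sup>+x\<in>box a b. ennreal (g x) \<partial>lborel)"
      by (simp only: nn[OF assms(1) f] nn[OF assms(2) g])
  qed measurable
  then show ?thesis
    by eventually_elim (use f g in \<open>auto simp: ennreal_inj\<close>)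
qed

text \<open>The kinetic equation in direction \<open>w\<close> says that $\<chi>(\<cdot>,\<xi>)$ does not change under translation by
\<open>w\<close>. Convexity keeps the support of a test function inside \<open>B\<close> while it is moved from its original
position to the position translated by \<open>w\<close>.\<close>

lemma chi_segment_invariant:
  fixes g :: "'a::euclidean_space \<Rightarrow> 'a"
  assumes [measurable]: "g \<in> borel_measurable borel"
    and B: "open B" "convex B"
    and kin: "\<And>\<phi>. \<phi> \<in> test_functions B \<Longrightarrow>
      (\<integral>x. chi g x \<xi> * frechet_derivative \<phi> (at x) w \<partial>lborel) = 0"
  shows "AE x in lborel. x \<in> B \<and> x + w \<in> B \<longrightarrow> (g (x + w) \<bullet> \<xi> > 0 \<longleftrightarrow> g x \<bullet> \<xi> > 0)"
proof -
  have chi_01: "chi g x \<xi> \<in> {0..1}" for x by (simp add: chi_def)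
  have [measurable]: "(\<lambda>x. chi g x \<xi>) \<in> borel_measurable borel"
    unfolding chi_def by measurable
  define U where "U = B \<inter> (\<lambda>x. x + w) -` B"
  have "open U"
    unfolding U_def by (intro open_Int B open_vimage continuous_intros)
  have "AE x in lborel. x \<in> U \<longrightarrow> chi g (x + w) \<xi> = chi g x \<xi>"
  proof (rule AE_eq_if_bump_integrals_eq)
    fix a b :: 'a and c :: real
    assume ab: "cbox a b \<subseteq> U" and c: "c > 0"
    let ?\<phi> = "box_bump c a b"
    have seg: "(\<lambda>x. ?\<phi> (x - t *\<^sub>R w)) \<in> test_functions B" if t: "t \<in> {0..1}" for t
    proof (rule test_function_translate)
      show "?\<phi> \<in> test_functions UNIV"
        by (rule box_bump_test_function[OF c]) simp
      fix x assume "x \<in> closure {x. ?\<phi> x \<noteq> 0}"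
      then have "x \<in> B" "x + w \<in> B" using closure_box_bump_support[of c a b] ab by (auto simp: U_def)
      then have "(1 - t) *\<^sub>R x + t *\<^sub>R (x + w) \<in> B"
        using t by (intro convexD[OF \<open>convex B\<close>]) auto
      then show "x + t *\<^sub>R w \<in> B" by (simp add: algebra_simps)
    qed
    have [measurable]: "?\<phi> \<in> borel_measurable borel"
      by (intro borel_measurable_continuous_onI cont_diff_continuous[of 0] cont_diff_box_bump c)
    have "(\<integral>x. chi g x \<xi> * ?\<phi> x \<partial>lborel) = (\<integral>x. chi g x \<xi> * ?\<phi> (x - w) \<partial>lborel)"
    proof (rule integral_translate_eq[symmetric])
      show "cont_diff (Suc 0) ?\<phi>" using c by (rule cont_diff_box_bump)
      show "compact (closure {x. ?\<phi> x \<noteq> 0})" by (simp add: box_bump_nonzero_iff)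
      show "\<bar>chi g x \<xi>\<bar> \<le> 1" for x using chi_01[of x] by auto
      fix t :: real assume "t \<in> {0..1}"
      from kin[OF seg[OF this]]
      show "(\<integral>x. chi g x \<xi> * frechet_derivative ?\<phi> (at (x - t *\<^sub>R w)) w \<partial>lborel) = 0"
        by (simp add: frechet_derivative_translate[OF cont_diff_box_bump[OF c]])
    qed simp
    also have "\<dots> = (\<integral>x. chi g x \<xi> * ?\<phi> (x - w) \<partial>distr lborel borel ((+) w))"
      by (simp add: lborel_distr_plus)
    also have "\<dots> = (\<integral>x. chi g (x + w) \<xi> * ?\<phi> x \<partial>lborel)"
      by (subst integral_distr) (auto simp: add.commute)
    finally show "(\<integral>x. chi g (x + w) \<xi> * ?\<phi> x \<partial>lborel) = (\<integral>x. chi g x \<xi> * ?\<phi> x \<partial>lborel)" ..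
  qed (use chi_01 \<open>open U\<close> in auto)
  then show ?thesis
    by eventually_elim (auto simp: U_def chi_def split: if_splits)
qed

section \<open>Pairs of points\<close>

text \<open>For \<open>w \<noteq> 0\<close> every vector orthogonal to \<open>w\<close> is of this form, and the formula is continuous in
all arguments. With \<open>a\<close> and \<open>b\<close> in a countable dense set it gives countably many vectors, dense in
the orthogonal complement of \<open>w\<close>, that depend measurably on \<open>w\<close>. So a single null set serves for all
of them.\<close>

definition skew :: "'a::real_inner \<Rightarrow> 'a \<Rightarrow> 'a \<Rightarrow> 'a" where
  "skew a b w = (a \<bullet> w) *\<^sub>R b - (b \<bullet> w) *\<^sub>R a"

lemma skew_orthogonal: "w \<bullet> skew a b w = 0"
  by (simp add: skew_def inner_diff_right inner_commute)

lemma skew_dense_orthogonal: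
  fixes D :: "'a::euclidean_space set"
  assumes D: "\<And>X. open X \<Longrightarrow> X \<noteq> {} \<Longrightarrow> \<exists>d\<in>D. d \<in> X"
    and "w \<noteq> 0" "w \<bullet> \<xi> = 0" "open V" "\<xi> \<in> V"
  shows "\<exists>a\<in>D. \<exists>b\<in>D. skew a b w \<in> V"
proof -
  define W where "W = (\<lambda>(a, b). skew a b w) -` V"
  have "open W"
    unfolding W_def skew_def case_prod_beta by (intro open_vimage assms continuous_intros)
  \<comment> \<open>These two vectors are a preimage of \<open>\<xi>\<close> itself.\<close>
  moreover have "(w /\<^sub>R (w \<bullet> w), \<xi>) \<in> W"
    using assms by (simp add: W_def skew_def inner_commute)
  ultimately obtain A C where AC: "open A" "open C" "w /\<^sub>R (w \<bullet> w) \<in> A" "\<xi> \<in> C" "A \<times> C \<subseteq> W"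
    by (rule open_prod_elim) auto
  obtain a where "a \<in> D" "a \<in> A" using D[OF AC(1)] AC(3) by auto
  obtain b where "b \<in> D" "b \<in> C" using D[OF AC(2)] AC(4) by auto
  have "(a, b) \<in> W" using \<open>a \<in> A\<close> \<open>b \<in> C\<close> AC(5) by auto
  with \<open>a \<in> D\<close> \<open>b \<in> D\<close> show ?thesis
    unfolding W_def by auto
qed

text \<open>On the hyperplane orthogonal to \<open>w\<close>, the vectors \<open>p\<close> and \<open>q\<close> act through their projections. By
density the two projections define the same open half-space of the hyperplane, so they are positive
multiples of each other, or both vanish.\<close>

lemma positively_parallel_modulo:
  fixes D :: "'a::euclidean_space set"
  assumes D: "\<And>X. open X \<Longrightarrow> X \<noteq> {} \<Longrightarrow> \<exists>d\<in>D. d \<in> X"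
    and w: "w \<noteq> 0"
    and sgn: "\<And>a b. a \<in> D \<Longrightarrow> b \<in> D \<Longrightarrow> p \<bullet> skew a b w > 0 \<longleftrightarrow> q \<bullet> skew a b w > 0"
  shows "\<exists>\<kappa>>0. \<exists>\<mu>. p - \<kappa> *\<^sub>R q = \<mu> *\<^sub>R w"
proof -
  define \<alpha> \<beta> where "\<alpha> = p \<bullet> w / (w \<bullet> w)" and "\<beta> = q \<bullet> w / (w \<bullet> w)"
  define p' q' where "p' = p - \<alpha> *\<^sub>R w" and "q' = q - \<beta> *\<^sub>R w"
  have orth: "w \<bullet> p' = 0" "w \<bullet> q' = 0"
    using w by (auto simp: p'_def q'_def \<alpha>_def \<beta>_def inner_diff_right inner_commute)
  have inner': "p \<bullet> \<xi> = p' \<bullet> \<xi>" "q \<bullet> \<xi> = q' \<bullet> \<xi>" if "w \<bullet> \<xi> = 0" for \<xi>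
    using that by (auto simp: p'_def q'_def inner_diff_left)
  have sgn': "p' \<bullet> skew a b w > 0 \<longleftrightarrow> q' \<bullet> skew a b w > 0" if "a \<in> D" "b \<in> D" for a b
    using sgn[OF that] inner'[OF skew_orthogonal[of w a b]] by simp
  have *: "\<exists>\<kappa>>0. p' = \<kappa> *\<^sub>R q'"
  proof (cases "p' = 0 \<or> q' = 0")
    case True
    have "p' = 0" if "q' = 0"
      using skew_dense_orthogonal[OF D w orth(1), of "{\<xi>. p' \<bullet> \<xi> > 0}"] sgn' that
      by (fastforce intro: open_halfspace_gt simp: inner_gt_zero_iff)
    moreover have "q' = 0" if "p' = 0"
      using skew_dense_orthogonal[OF D w orth(2), of "{\<xi>. q' \<bullet> \<xi> > 0}"] sgn' that
      by (fastforce intro: open_halfspace_gt simp: inner_gt_zero_iff)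
    ultimately show ?thesis using True by (intro exI[of _ 1]) auto
  next
    case False
    \<comment> \<open>Unless the two unit vectors agree, their difference lies strictly inside one half-space and
      strictly outside the other.\<close>
    define \<xi> where "\<xi> = p' /\<^sub>R norm p' - q' /\<^sub>R norm q'"
    have "w \<bullet> \<xi> = 0" using orth by (simp add: \<xi>_def inner_diff_right)
    have "\<not> (p' \<bullet> \<xi> > 0 \<and> q' \<bullet> \<xi> < 0)"
    proof
      assume "p' \<bullet> \<xi> > 0 \<and> q' \<bullet> \<xi> < 0"
      then have "\<xi> \<in> {\<xi>. p' \<bullet> \<xi> > 0} \<inter> {\<xi>. q' \<bullet> \<xi> < 0}" by simp
      then obtain a b where "a \<in> D" "b \<in> D" "skew a b w \<in> {\<xi>. p' \<bullet> \<xi> > 0} \<inter> {\<xi>. q' \<bullet> \<xi> < 0}"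
        using skew_dense_orthogonal[OF D w \<open>w \<bullet> \<xi> = 0\<close>] open_halfspace_gt open_halfspace_lt
        by (metis open_Int)
      then show False using sgn'[of a b] by auto
    qed
    moreover have "p' \<bullet> \<xi> = norm p' - p' \<bullet> q' / norm q'" "q' \<bullet> \<xi> = p' \<bullet> q' / norm p' - norm q'"
      using False by (simp_all add: \<xi>_def inner_diff_right dot_square_norm power2_eq_square
          divide_inverse inner_commute)
    ultimately have "\<not> p' \<bullet> q' < norm p' * norm q'"
      using False by (auto simp: pos_divide_less_eq mult.commute)
    then have "p' \<bullet> q' = norm p' * norm q'"
      using norm_cauchy_schwarz[of p' q'] by linarith
    then have "norm p' *\<^sub>R q' = norm q' *\<^sub>R p'"
      by (simp add: norm_cauchy_schwarz_eq)
    then have "p' = (norm p' / norm q') *\<^sub>R q'"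
      using False by (simp add: eq_vector_fraction_iff)
    then show ?thesis using False by (intro exI[of _ "norm p' / norm q'"]) auto
  qed
  then obtain \<kappa> where "\<kappa> > 0" "p' = \<kappa> *\<^sub>R q'" by blast
  then have "p - \<kappa> *\<^sub>R q = (\<alpha> - \<kappa> * \<beta>) *\<^sub>R w"
    by (simp add: p'_def q'_def algebra_simps)
  with \<open>\<kappa> > 0\<close> show ?thesis by blast
qed

text \<open>The conclusion says that the lines through \<open>x\<close> and \<open>y\<close> in the directions \<open>g x\<close> and \<open>g y\<close> are
coplanar, with a compatible orientation. The values of $\<chi>(\<cdot>,\<xi>)$ at \<open>x\<close> and \<open>y\<close> agree for all
\<open>\<xi>\<close> in a dense subset of the hyperplane orthogonal to \<open>y - x\<close>. For a fixed difference \<open>w = y - x\<close> this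
holds for almost every \<open>x\<close>, and Fubini's theorem exchanges the roles of \<open>w\<close> and \<open>x\<close>.\<close>

lemma AE_pairs_coplanar:
  fixes g :: "'a::euclidean_space \<Rightarrow> 'a"
  assumes g[measurable]: "g \<in> borel_measurable borel"
    and B: "open B" "convex B"
    and kin: "\<And>\<phi> w \<xi>. \<phi> \<in> test_functions B \<Longrightarrow> w \<bullet> \<xi> = 0 \<Longrightarrow>
      (\<integral>x. chi g x \<xi> * frechet_derivative \<phi> (at x) w \<partial>lborel) = 0"
  shows "AE x in lborel. AE y in lborel. x \<in> B \<and> y \<in> B \<longrightarrow>
           (\<exists>\<kappa>>0. \<exists>\<mu>. g x - \<kappa> *\<^sub>R g y = \<mu> *\<^sub>R (x - y))"
proof -
  obtain D :: "'a set" where D: "countable D" "\<And>X. open X \<Longrightarrow> X \<noteq> {} \<Longrightarrow> \<exists>d\<in>D. d \<in> X"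
    using countable_dense_exists by blast
  have [measurable]: "B \<in> sets borel" using B by simp
  have pair: "AE x in lborel. AE y in lborel. x \<in> B \<and> y \<in> B \<longrightarrow>
      (g y \<bullet> skew a b (y - x) > 0 \<longleftrightarrow> g x \<bullet> skew a b (y - x) > 0)" for a b
  proof -
    let ?P = "\<lambda>x w. x \<in> B \<and> x + w \<in> B \<longrightarrow>
      (g (x + w) \<bullet> skew a b w > 0 \<longleftrightarrow> g x \<bullet> skew a b w > 0)"
    have "AE x in lborel. ?P x w" for w
      by (rule chi_segment_invariant[OF g B kin[OF _ skew_orthogonal]])
    then have "AE w in lborel. AE x in lborel. ?P x w" by simp
    moreover have "{z \<in> space (lborel \<Otimes>\<^sub>M lborel). ?P (fst z) (snd z)} \<in> sets (lborel \<Otimes>\<^sub>M lborel)"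
      unfolding skew_def by measurable
    ultimately have "AE x in lborel. AE w in lborel. ?P x w"
      by (subst lborel_pair.AE_commute) auto
    then show ?thesis
    proof eventually_elim
      fix x assume "AE w in lborel. ?P x w"
      then have "AE w in distr lborel borel ((+) (- x)). ?P x w"
        unfolding lborel_distr_plus .
      from AE_distrD[OF _ this] show "AE y in lborel. x \<in> B \<and> y \<in> B \<longrightarrow>
          (g y \<bullet> skew a b (y - x) > 0 \<longleftrightarrow> g x \<bullet> skew a b (y - x) > 0)"
        by simp
    qed
  qed
  have "AE x in lborel. \<forall>a\<in>D. \<forall>b\<in>D. AE y in lborel. x \<in> B \<and> y \<in> B \<longrightarrow>
      (g y \<bullet> skew a b (y - x) > 0 \<longleftrightarrow> g x \<bullet> skew a b (y - x) > 0)"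
    by (simp add: AE_ball_countable[OF D(1)] pair)
  then show ?thesis
  proof eventually_elim
    fix x
    assume "\<forall>a\<in>D. \<forall>b\<in>D. AE y in lborel. x \<in> B \<and> y \<in> B \<longrightarrow>
      (g y \<bullet> skew a b (y - x) > 0 \<longleftrightarrow> g x \<bullet> skew a b (y - x) > 0)"
    then have "AE y in lborel. \<forall>a\<in>D. \<forall>b\<in>D. x \<in> B \<and> y \<in> B \<longrightarrow>
      (g y \<bullet> skew a b (y - x) > 0 \<longleftrightarrow> g x \<bullet> skew a b (y - x) > 0)"
      by (simp only: AE_ball_countable[OF D(1)])
    moreover have "AE y in lborel. y \<noteq> x"
      by (rule AE_lborel_singleton)
    ultimately show "AE y in lborel. x \<in> B \<and> y \<in> B \<longrightarrow>
        (\<exists>\<kappa>>0. \<exists>\<mu>. g x - \<kappa> *\<^sub>R g y = \<mu> *\<^sub>R (x - y))"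
    proof eventually_elim
      fix y
      assume *: "\<forall>a\<in>D. \<forall>b\<in>D. x \<in> B \<and> y \<in> B \<longrightarrow>
          (g y \<bullet> skew a b (y - x) > 0 \<longleftrightarrow> g x \<bullet> skew a b (y - x) > 0)" and "y \<noteq> x"
      show "x \<in> B \<and> y \<in> B \<longrightarrow> (\<exists>\<kappa>>0. \<exists>\<mu>. g x - \<kappa> *\<^sub>R g y = \<mu> *\<^sub>R (x - y))"
      proof
        assume "x \<in> B \<and> y \<in> B"
        then obtain \<kappa> \<mu> where "\<kappa> > 0" "g x - \<kappa> *\<^sub>R g y = \<mu> *\<^sub>R (y - x)"
          using positively_parallel_modulo[OF D(2), of "y - x" "g x" "g y"] * \<open>y \<noteq> x\<close> by auto
        then have "\<kappa> > 0" "g x - \<kappa> *\<^sub>R g y = (- \<mu>) *\<^sub>R (x - y)"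
          by (auto simp: algebra_simps)
        then show "\<exists>\<kappa>>0. \<exists>\<mu>. g x - \<kappa> *\<^sub>R g y = \<mu> *\<^sub>R (x - y)" by blast
      qed
    qed
  qed
qed

section \<open>Triples of points\<close>

lemma AE_notin_translated_span:
  fixes S :: "'a::euclidean_space set"
  assumes "finite S" "card S < DIM('a)"
  shows "AE x in lborel. x - P \<notin> span S"
proof -
  have "dim (span S) \<le> card S"
    using assms(1) by (simp add: dim_span dim_le_card')
  then have "negligible (span S)"
    using assms by (intro negligible_lowdim) simp
  then have "AE x in lborel. x \<notin> (+) P ` span S"
    by (intro AE_lborel_negligible negligible_translation)
  then show ?thesis
    by eventually_elim (metis add_diff_cancel_left' diff_add_cancel image_eqI add.commute)
qed

text \<open>The lines through \<open>x\<close> and \<open>y\<close> meet at $P = x - e/\<mu>$. A line through a point \<open>z\<close> outside their common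
plane that is coplanar with each of them must pass through \<open>P\<close>, because \<open>h\<close> lies both in the span of
\<open>e\<close> and $z - P$ and in the span of \<open>f\<close> and $z - P$. The sign of \<open>\<mu>\<close> tells whether \<open>e\<close> points away
from \<open>P\<close> or towards it, and \<open>h\<close> inherits it.\<close>

lemma third_line_through_intersection:
  fixes e f h :: "'a::euclidean_space"
  assumes "norm e = 1" "norm f = 1" "norm h = 1" "e \<noteq> f" and y: "y - x \<notin> span {e}"
    and \<kappa>: "\<kappa> > 0" "e - \<kappa> *\<^sub>R f = \<mu> *\<^sub>R (x - y)"
    and \<kappa>1: "\<kappa>1 > 0" "e - \<kappa>1 *\<^sub>R h = \<mu>1 *\<^sub>R (x - z)"
    and \<kappa>2: "\<kappa>2 > 0" "f - \<kappa>2 *\<^sub>R h = \<mu>2 *\<^sub>R (y - z)"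
    and z: "z - (x - e /\<^sub>R \<mu>) \<notin> span {e, f}"
  shows "h = sgn \<mu> *\<^sub>R vortex (z - (x - e /\<^sub>R \<mu>))"
proof -
  define z' where "z' = z - (x - e /\<^sub>R \<mu>)"
  have "\<mu> \<noteq> 0"
  proof
    assume "\<mu> = 0"
    then have "e = \<kappa> *\<^sub>R f" using \<kappa> by simp
    moreover from this have "\<kappa> = 1" using assms(1,2) \<kappa>(1) by simp
    ultimately show False using \<open>e \<noteq> f\<close> by simp
  qed
  have f_notin: "f \<notin> span {e}"
  proof
    assume "f \<in> span {e}"
    then have "e - \<kappa> *\<^sub>R f \<in> span {e}"
      by (intro span_diff span_scale) (simp_all add: span_base)
    then have "(- 1 / \<mu>) *\<^sub>R (\<mu> *\<^sub>R (x - y)) \<in> span {e}"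
      unfolding \<kappa>(2) by (rule span_scale)
    also have "(- 1 / \<mu>) *\<^sub>R (\<mu> *\<^sub>R (x - y)) = y - x"
      using \<open>\<mu> \<noteq> 0\<close> by (simp add: algebra_simps)
    finally show False using y by contradiction
  qed
  have "e \<noteq> 0" using assms by auto
  have xz: "x - z = e /\<^sub>R \<mu> - z'" by (simp add: z'_def)
  have "y = x - (1 / \<mu>) *\<^sub>R (\<mu> *\<^sub>R (x - y))" using \<open>\<mu> \<noteq> 0\<close> by simp
  then have yz: "y - z = (\<kappa> / \<mu>) *\<^sub>R f - z'"
    unfolding \<kappa>(2)[symmetric] by (simp add: z'_def algebra_simps divide_inverse)
  have h1: "\<kappa>1 *\<^sub>R h = (1 - \<mu>1 / \<mu>) *\<^sub>R e + \<mu>1 *\<^sub>R z'"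
    using \<kappa>1(2) unfolding xz by (simp add: algebra_simps divide_inverse)
  have h2: "\<kappa>2 *\<^sub>R h = (1 - \<mu>2 * \<kappa> / \<mu>) *\<^sub>R f + \<mu>2 *\<^sub>R z'"
    using \<kappa>2(2) unfolding yz by (simp add: algebra_simps divide_inverse)
  \<comment> \<open>Comparing the two expressions for \<open>h\<close> gives a relation between the independent vectors \<open>e\<close>, \<open>f\<close>
    and \<open>z'\<close>, so its coefficients vanish.\<close>
  define a where "a = \<kappa>2 * (1 - \<mu>1 / \<mu>)"
  define b where "b = \<kappa>1 * (1 - \<mu>2 * \<kappa> / \<mu>)"
  define c where "c = \<kappa>1 * \<mu>2 - \<kappa>2 * \<mu>1"
  have "\<kappa>2 *\<^sub>R (\<kappa>1 *\<^sub>R h) = \<kappa>1 *\<^sub>R (\<kappa>2 *\<^sub>R h)" by simp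
  then have rel: "c *\<^sub>R z' = a *\<^sub>R e - b *\<^sub>R f"
    unfolding h1 h2 by (simp add: a_def b_def c_def algebra_simps)
  have "c = 0"
  proof (rule ccontr)
    assume "c \<noteq> 0"
    then have "z' = (1 / c) *\<^sub>R (a *\<^sub>R e - b *\<^sub>R f)" unfolding rel[symmetric] by simp
    also have "\<dots> \<in> span {e, f}" by (intro span_scale span_diff span_base) auto
    finally show False using z by (simp add: z'_def)
  qed
  have "b = 0"
  proof (rule ccontr)
    assume "b \<noteq> 0"
    then have "f = (1 / b) *\<^sub>R (b *\<^sub>R f)" by simp
    also have "b *\<^sub>R f = a *\<^sub>R e" using rel \<open>c = 0\<close> by simp
    also have "(1 / b) *\<^sub>R (a *\<^sub>R e) \<in> span {e}" by (intro span_scale span_base) auto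
    finally show False using f_notin by simp
  qed
  then have "a = 0" using rel \<open>c = 0\<close> \<open>e \<noteq> 0\<close> by simp
  then have "\<mu>1 = \<mu>" using \<kappa>2(1) \<open>\<mu> \<noteq> 0\<close> by (simp add: a_def)
  then have h: "\<kappa>1 *\<^sub>R h = \<mu> *\<^sub>R z'" using h1 \<open>\<mu> \<noteq> 0\<close> by simp
  then have "norm (\<kappa>1 *\<^sub>R h) = norm (\<mu> *\<^sub>R z')" by simp
  then have "\<kappa>1 = \<bar>\<mu>\<bar> * norm z'" using \<kappa>1(1) assms(3) by simp
  then have "h = (1 / (\<bar>\<mu>\<bar> * norm z')) *\<^sub>R (\<kappa>1 *\<^sub>R h)" using \<kappa>1(1) by auto
  also have "\<dots> = sgn \<mu> *\<^sub>R vortex z'"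
    unfolding h by (simp add: vortex_def sgn_real_def divide_inverse)
  finally show ?thesis by (simp add: z'_def)
qed

definition const_or_vortex :: "('a::euclidean_space \<Rightarrow> 'a) set" where
  "const_or_vortex = {f. (\<exists>c. f = (\<lambda>x. c)) \<or> (\<exists>P. \<exists>\<gamma>\<in>{1, -1}. f = (\<lambda>x. \<gamma> *\<^sub>R vortex (x - P)))}"

lemma const_or_vortexE:
  assumes "f \<in> const_or_vortex"
  obtains (const) c where "f = (\<lambda>x. c)"
    | (vortex) P \<gamma> where "\<gamma> \<in> {1, -1}" "f = (\<lambda>x. \<gamma> *\<^sub>R vortex (x - P))"
  using assms unfolding const_or_vortex_def
  by (elim CollectE disjE exE bexE) (erule that(1), erule (1) that(2))

text \<open>If \<open>g\<close> is not constant, then two points \<open>x\<close> and \<open>y\<close> can be chosen whose lines are distinct and not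
parallel, and almost every third line passes through their intersection. This is where
the dimension enters: from three on, the plane of the two lines has measure zero.\<close>

lemma const_or_vortex_if_coplanar:
  fixes g :: "'a::euclidean_space \<Rightarrow> 'a"
  assumes dim: "DIM('a) \<ge> 3"
    and unit: "AE x in lborel. x \<in> B \<longrightarrow> norm (g x) = 1"
    and cop: "AE x in lborel. AE y in lborel. x \<in> B \<and> y \<in> B \<longrightarrow>
                (\<exists>\<kappa>>0. \<exists>\<mu>. g x - \<kappa> *\<^sub>R g y = \<mu> *\<^sub>R (x - y))"
  shows "\<exists>f\<in>const_or_vortex. AE x in lborel. x \<in> B \<longrightarrow> g x = f x"
proof (cases "\<exists>c. AE x in lborel. x \<in> B \<longrightarrow> g x = c")
  case True
  then show ?thesis
    by (auto simp: const_or_vortex_def intro!: bexI[of _ "\<lambda>x. _"])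
next
  case False
  define R where "R = (\<lambda>x y. \<exists>\<kappa>>0. \<exists>\<mu>. g x - \<kappa> *\<^sub>R g y = \<mu> *\<^sub>R (x - y))"
  define G where "G = (\<lambda>x. norm (g x) = 1 \<and> (AE y in lborel. y \<in> B \<longrightarrow> R x y))"
  have G: "AE x in lborel. x \<in> B \<longrightarrow> G x"
    using unit cop by eventually_elim (auto simp: G_def R_def)
  have pick: "\<exists>x\<in>B. Q x \<and> g x \<noteq> c" if "AE x in lborel. x \<in> B \<longrightarrow> Q x" for Q c
  proof (rule ccontr)
    assume *: "\<not> (\<exists>x\<in>B. Q x \<and> g x \<noteq> c)"
    from that have "AE x in lborel. x \<in> B \<longrightarrow> g x = c"
      by eventually_elim (use * in auto)
    then show False using False by blast
  qed
  obtain x where x: "x \<in> B" "G x"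
    using pick[OF G] by blast
  have "AE y in lborel. y \<in> B \<longrightarrow> R x y"
    using x by (simp add: G_def)
  moreover have "AE y in lborel. y - x \<notin> span {g x}"
    using dim by (intro AE_notin_translated_span) auto
  ultimately have "AE y in lborel. y \<in> B \<longrightarrow> G y \<and> R x y \<and> y - x \<notin> span {g x}"
    using G by eventually_elim auto
  from pick[OF this] obtain y where y: "y \<in> B" "G y" "R x y" "y - x \<notin> span {g x}" "g y \<noteq> g x"
    by blast
  obtain \<kappa> \<mu> where \<kappa>: "\<kappa> > 0" "g x - \<kappa> *\<^sub>R g y = \<mu> *\<^sub>R (x - y)"
    using y(3) by (auto simp: R_def)
  define P where "P = x - g x /\<^sub>R \<mu>"
  have "\<mu> \<noteq> 0"
  proof
    assume "\<mu> = 0"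
    then have eq: "g x = \<kappa> *\<^sub>R g y" using \<kappa> by simp
    then have "norm (g x) = \<kappa> * norm (g y)" using \<kappa>(1) by simp
    then have "\<kappa> = 1" using x(2) y(2) by (simp add: G_def)
    then show False using eq y(5) by simp
  qed
  have "card {g x, g y} < DIM('a)"
    using dim card_insert_le_m1[of 2 "{g y}" "g x"] by simp
  then have "AE z in lborel. z - P \<notin> span {g x, g y}"
    by (intro AE_notin_translated_span) auto
  moreover have "AE z in lborel. z \<in> B \<longrightarrow> R x z" "AE z in lborel. z \<in> B \<longrightarrow> R y z"
    using x y by (auto simp: G_def)
  ultimately have "AE z in lborel. z \<in> B \<longrightarrow> g z = sgn \<mu> *\<^sub>R vortex (z - P)"
    using unit
  proof eventually_elim
    case (elim z)
    show ?case
    proof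
      assume "z \<in> B"
      then obtain \<kappa>1 \<mu>1 \<kappa>2 \<mu>2 where
        "\<kappa>1 > 0" "g x - \<kappa>1 *\<^sub>R g z = \<mu>1 *\<^sub>R (x - z)"
        "\<kappa>2 > 0" "g y - \<kappa>2 *\<^sub>R g z = \<mu>2 *\<^sub>R (y - z)"
        using elim unfolding R_def by blast
      then show "g z = sgn \<mu> *\<^sub>R vortex (z - P)"
        unfolding P_def using elim \<open>z \<in> B\<close> x y \<kappa>
        by (intro third_line_through_intersection[of "g x" "g y" "g z" y x \<kappa> \<mu> \<kappa>1 \<mu>1 z \<kappa>2 \<mu>2])
           (auto simp: G_def P_def)
    qed
  qed
  moreover have "sgn \<mu> \<in> {1, -1}"
    using \<open>\<mu> \<noteq> 0\<close> by (simp add: sgn_real_def)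
  then have "(\<lambda>z. sgn \<mu> *\<^sub>R vortex (z - P)) \<in> const_or_vortex"
    unfolding const_or_vortex_def by blast
  ultimately show ?thesis
    by (intro bexI[of _ "\<lambda>z. sgn \<mu> *\<^sub>R vortex (z - P)"])
qed


section \<open>From balls to connected sets\<close>

lemma vortex_eq_imp_parallel:
  assumes "\<gamma> *\<^sub>R vortex (z - P) = c" "\<gamma> \<noteq> 0"
  shows "z - P \<in> span {c}"
proof -
  have "z - P = (norm (z - P) / \<gamma>) *\<^sub>R c"
    using assms(2) unfolding assms(1)[symmetric] by (cases "z = P") (simp_all add: vortex_def)
  then show ?thesis by (metis span_base span_scale singletonI)
qed

text \<open>The points where two different candidates agree lie on a line, if there are any: for vortices with
different centres it is the line through both centres, for a vortex and a constant the line through the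
centre in the direction of the constant. Opposite vortices with the same centre agree only there.\<close>

lemma const_or_vortex_AE_distinct:
  fixes f f' :: "'a::euclidean_space \<Rightarrow> 'a"
  assumes dim: "DIM('a) \<ge> 2" and f: "f \<in> const_or_vortex" "f' \<in> const_or_vortex" "f \<noteq> f'"
  shows "AE z in lborel. f z \<noteq> f' z"
proof -
  have const_vortex: "AE z in lborel. \<gamma> *\<^sub>R vortex (z - P) \<noteq> c"
    if "\<gamma> \<in> {1, -1}" for c P :: 'a and \<gamma>
  proof -
    have "AE z in lborel. z - P \<notin> span {c}"
      using dim by (intro AE_notin_translated_span) auto
    then show ?thesis
    proof eventually_elim
      fix z assume "z - P \<notin> span {c}"
      then show "\<gamma> *\<^sub>R vortex (z - P) \<noteq> c"
        using vortex_eq_imp_parallel[of \<gamma> z P c] that by auto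
    qed
  qed
  have vortex_vortex: "AE z in lborel. \<gamma> *\<^sub>R vortex (z - P) \<noteq> \<gamma>' *\<^sub>R vortex (z - P')"
    if \<gamma>: "\<gamma> \<in> {1, -1}" "\<gamma>' \<in> {1, -1}" and ne: "P \<noteq> P' \<or> \<gamma> \<noteq> \<gamma>'" for P P' :: 'a and \<gamma> \<gamma>'
  proof -
    have "AE z in lborel. z - P \<notin> span {P' - P}"
      using dim by (intro AE_notin_translated_span) auto
    then show ?thesis
    proof eventually_elim
      fix z
      assume z: "z - P \<notin> span {P' - P}"
      show "\<gamma> *\<^sub>R vortex (z - P) \<noteq> \<gamma>' *\<^sub>R vortex (z - P')"
      proof
        assume eq: "\<gamma> *\<^sub>R vortex (z - P) = \<gamma>' *\<^sub>R vortex (z - P')"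
        have "z \<noteq> P" using z span_zero[of "{P' - P}"] by auto
        have "z \<noteq> P'" using z span_base[of "P' - P" "{P' - P}"] by auto
        define s where "s = \<gamma> / norm (z - P) - \<gamma>' / norm (z - P')"
        have "s *\<^sub>R (z - P) = (- \<gamma>' / norm (z - P')) *\<^sub>R (P' - P)"
          using eq by (simp add: s_def vortex_def algebra_simps divide_inverse)
        then have s: "s *\<^sub>R (z - P) = (- \<gamma>' / norm (z - P')) *\<^sub>R (P' - P)" .
        show False
        proof (cases "s = 0")
          case True
          then have "P' = P" using s \<gamma> \<open>z \<noteq> P'\<close> by auto
          then show False using True ne \<open>z \<noteq> P\<close> by (simp add: s_def)
        next
          case False
          then have "z - P = (1 / s) *\<^sub>R (s *\<^sub>R (z - P))" by simp
          also have "\<dots> \<in> span {P' - P}"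
            unfolding s by (intro span_scale span_base) simp
          finally show False using z by simp
        qed
      qed
    qed
  qed
  show ?thesis
    using f(1)
  proof (cases rule: const_or_vortexE)
    case (const c)
    note f_eq = this
    from f(2) show ?thesis
    proof (cases rule: const_or_vortexE)
      case (const c')
      have "c \<noteq> c'" using f(3) unfolding f_eq const by (rule contrapos_nn) simp
      then show ?thesis unfolding f_eq const by simp
    next
      case (vortex P \<gamma>)
      have "AE z in lborel. \<gamma> *\<^sub>R vortex (z - P) \<noteq> c"
        using vortex(1) by (rule const_vortex)
      then show ?thesis unfolding f_eq vortex(2) by eventually_elim (rule not_sym)
    qed
  next
    case (vortex P \<gamma>)
    note f_eq = this
    from f(2) show ?thesis
    proof (cases rule: const_or_vortexE)
      case (const c)
      show ?thesis unfolding f_eq(2) const using f_eq(1) by (rule const_vortex)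
    next
      case (vortex P' \<gamma>')
      have "P \<noteq> P' \<or> \<gamma> \<noteq> \<gamma>'" using f(3) f_eq(2) vortex(2) by blast
      then show ?thesis unfolding f_eq(2) vortex(2) by (rule vortex_vortex[OF f_eq(1) vortex(1)])
    qed
  qed
qed

text \<open>For each candidate \<open>f\<close>, the largest open set on which \<open>g = f\<close> almost everywhere is considered. Two of these
sets for different candidates are disjoint, since their open intersection has measure zero; so a connected
set covered by them lies in one of them.\<close>

lemma AE_glue_connected:
  fixes g :: "'a::euclidean_space \<Rightarrow> 'b" and F :: "('a \<Rightarrow> 'b) set"
  assumes \<Omega>: "connected \<Omega>"
    and distinct: "\<And>f f'. f \<in> F \<Longrightarrow> f' \<in> F \<Longrightarrow> f \<noteq> f' \<Longrightarrow> AE x in lborel. f x \<noteq> f' x"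
    and local: "\<And>x. x \<in> \<Omega> \<Longrightarrow> \<exists>r>0. \<exists>f\<in>F. AE z in lborel. z \<in> ball x r \<longrightarrow> g z = f z"
    and "\<Omega> \<noteq> {}"
  shows "\<exists>f\<in>F. AE x in lborel. x \<in> \<Omega> \<longrightarrow> g x = f x"
proof -
  define T where "T = (\<lambda>f. \<Union>{U. open U \<and> (AE z in lborel. z \<in> U \<longrightarrow> g z = f z)})"
  have "open (T f)" for f
    by (auto simp: T_def)
  have T_AE: "AE z in lborel. z \<in> T f \<longrightarrow> g z = f z" for f
  proof -
    obtain \<U> where "\<U> \<subseteq> {U. open U \<and> (AE z in lborel. z \<in> U \<longrightarrow> g z = f z)}" "countable \<U>" "\<Union>\<U> = T f"
      unfolding T_def
      by (rule Lindelof[of "{U. open U \<and> (AE z in lborel. z \<in> U \<longrightarrow> g z = f z)}"]) auto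
    moreover from this have "AE z in lborel. \<forall>U\<in>\<U>. z \<in> U \<longrightarrow> g z = f z"
      by (auto simp only: AE_ball_countable)
    ultimately show ?thesis
      by (auto elim!: eventually_mono)
  qed
  have disj: "T f \<inter> T f' = {}" if "f \<in> F" "f' \<in> F" "f \<noteq> f'" for f f'
  proof -
    have "AE z in lborel. z \<notin> T f \<inter> T f'"
      using T_AE[of f] T_AE[of f'] distinct[OF that] by eventually_elim auto
    then have "AE z in lebesgue. z \<notin> T f \<inter> T f'"
      by (rule AE_completion)
    moreover have "T f \<inter> T f' \<in> sets lebesgue"
      using \<open>\<And>f. open (T f)\<close> by simp
    ultimately have "negligible (T f \<inter> T f')"
      by (simp only: negligible_iff_null_sets AE_iff_null_sets)
    moreover have "open (T f \<inter> T f')"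
      using \<open>\<And>f. open (T f)\<close> by (intro open_Int)
    ultimately show ?thesis
      using open_not_negligible by metis
  qed
  have cover: "\<exists>f\<in>F. x \<in> T f" if "x \<in> \<Omega>" for x
  proof -
    obtain r f where "r > 0" "f \<in> F" "AE z in lborel. z \<in> ball x r \<longrightarrow> g z = f z"
      using local[OF \<open>x \<in> \<Omega>\<close>] by blast
    then have "ball x r \<subseteq> T f" "x \<in> ball x r"
      unfolding T_def by (auto intro!: Union_upper)
    with \<open>f \<in> F\<close> show ?thesis by blast
  qed
  obtain x0 f0 where x0: "x0 \<in> \<Omega>" "f0 \<in> F" "x0 \<in> T f0"
    using cover \<open>\<Omega> \<noteq> {}\<close> by blast
  have "T f0 \<inter> \<Omega> = {} \<or> (\<Union>f\<in>F - {f0}. T f) \<inter> \<Omega> = {}"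
  proof (rule connectedD[OF \<Omega>])
    show "open (T f0)" "open (\<Union>f\<in>F - {f0}. T f)" using \<open>\<And>f. open (T f)\<close> by auto
    show "T f0 \<inter> (\<Union>f\<in>F - {f0}. T f) \<inter> \<Omega> = {}" using disj x0(2) by fastforce
    show "\<Omega> \<subseteq> T f0 \<union> (\<Union>f\<in>F - {f0}. T f)" using cover by fastforce
  qed
  then have "\<Omega> \<subseteq> T f0" using x0 cover by blast
  with T_AE[of f0] x0(2) show ?thesis
    by (auto elim!: eventually_mono)
qed


section \<open>Borel representatives of kinetic solutions\<close>

lemma lebesgue_ex_borel_measurable:
  fixes u :: "'a::euclidean_space \<Rightarrow> 'b::euclidean_space"
  assumes "u \<in> borel_measurable lebesgue"
  shows "\<exists>g\<in>borel_measurable borel. AE x in lborel. u x = g x"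
proof -
  have "\<exists>h\<in>borel_measurable lborel. AE x in lborel. u x \<bullet> i = h x" for i
    using assms by (intro completion_ex_borel_measurable_real borel_measurable_inner borel_measurable_const)
  then obtain h where h: "\<And>i. h i \<in> borel_measurable lborel" "\<And>i. AE x in lborel. u x \<bullet> i = h i x"
    by metis
  define g where "g x = (\<Sum>i\<in>Basis. h i x *\<^sub>R i)" for x
  have "g \<in> borel_measurable borel"
    using h(1) unfolding g_def by simp
  moreover have "AE x in lborel. \<forall>i\<in>Basis. u x \<bullet> i = h i x"
    using h(2) by (intro AE_finite_allI) auto
  then have "AE x in lborel. u x = g x"
    by eventually_elim (simp add: g_def euclidean_eq_iff[where 'a='b])
  ultimately show ?thesis by blast
qed

lemma AE_lebesgue_on_iff:
  fixes \<Omega> :: "'a::euclidean_space set"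
  assumes "open \<Omega>"
  shows "(AE x in lebesgue_on \<Omega>. P x) \<longleftrightarrow> (AE x in lborel. x \<in> \<Omega> \<longrightarrow> P x)"
  using assms by (subst AE_restrict_space_iff) (simp_all add: AE_completion_iff)

text \<open>Passing to a Borel representative \<open>g\<close> is what makes \<open>g (x + w)\<close> jointly measurable in \<open>x\<close> and \<open>w\<close>;
Lebesgue measurability alone is not stable under this composition. The normalisation of \<open>\<xi>\<close> can be
dropped because $\<chi>$ depends only on the direction of \<open>\<xi>\<close>.\<close>

lemma kinetic_formulation_borel:
  fixes u g :: "'a::euclidean_space \<Rightarrow> 'a"
  assumes \<Omega>: "open \<Omega>" and kin: "kinetic_formulation \<Omega> u"
    and u: "u \<in> borel_measurable (lebesgue_on \<Omega>)" and g: "g \<in> borel_measurable borel"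
    and ug: "AE x in lebesgue_on \<Omega>. u x = g x"
    and \<phi>: "\<phi> \<in> test_functions \<Omega>" and w: "w \<bullet> \<xi> = 0"
  shows "(\<integral>x. chi g x \<xi> * frechet_derivative \<phi> (at x) w \<partial>lborel) = 0"
proof (cases "\<xi> = 0")
  case True
  then show ?thesis by (simp add: chi_def)
next
  case False
  define D where "D = (\<lambda>x. frechet_derivative \<phi> (at x) w)"
  define \<eta> where "\<eta> = \<xi> /\<^sub>R norm \<xi>"
  have chi_\<eta>: "chi g x \<xi> = chi g x \<eta>" for x
    using False by (simp add: \<eta>_def chi_def zero_less_mult_iff)
  have "cont_diff (Suc 0) \<phi>"
    using \<phi> by (simp add: test_functions_def del: cont_diff.simps)
  note supp = frechet_derivative_zero_off_support[OF this]
  have D: "D \<in> borel_measurable borel"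
    using \<open>cont_diff (Suc 0) \<phi>\<close> by (auto simp: D_def intro: borel_measurable_continuous_onI)
  have zero: "D x = 0" if "x \<notin> \<Omega>" for x
    using supp[of x w] that \<phi> by (auto simp: D_def test_functions_def)
  have g\<eta>: "(\<lambda>x. chi g x \<eta> * D x) \<in> borel_measurable borel"
    using g D unfolding chi_def by measurable
  have to_\<Omega>: "f \<in> borel_measurable (lebesgue_on \<Omega>)" if "f \<in> borel_measurable borel" for f :: "'a \<Rightarrow> real"
    using that by (intro measurable_restrict_space1 measurable_completion) simp
  have "(\<integral>x. chi g x \<xi> * D x \<partial>lborel) = (\<integral>x. chi g x \<eta> * D x \<partial>lebesgue)"
    unfolding chi_\<eta> using g\<eta> by (intro integral_completion[symmetric]) simp
  also have "\<dots> = (\<integral>x. indicator \<Omega> x *\<^sub>R (chi g x \<eta> * D x) \<partial>lebesgue)"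
    by (intro Bochner_Integration.integral_cong) (auto simp: indicator_def zero)
  also have "\<dots> = (\<integral>x. chi g x \<eta> * D x \<partial>lebesgue_on \<Omega>)"
    using \<Omega> by (intro integral_restrict_space[symmetric]) simp
  also have "\<dots> = (\<integral>x. chi u x \<eta> * D x \<partial>lebesgue_on \<Omega>)"
  proof (rule integral_cong_AE)
    show "(\<lambda>x. chi g x \<eta> * D x) \<in> borel_measurable (lebesgue_on \<Omega>)"
      using g\<eta> by (rule to_\<Omega>)
    show "(\<lambda>x. chi u x \<eta> * D x) \<in> borel_measurable (lebesgue_on \<Omega>)"
      using u to_\<Omega>[OF D] unfolding chi_def by measurable
    show "AE x in lebesgue_on \<Omega>. chi g x \<eta> * D x = chi u x \<eta> * D x"
      using ug by eventually_elim (simp add: chi_def)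
  qed
  also have "\<dots> = 0"
  proof -
    have "\<eta> \<in> sphere 0 1" "w \<bullet> \<eta> = 0"
      using False w by (simp_all add: \<eta>_def)
    then have "distr_dir_deriv \<Omega> w (\<lambda>x. chi u x \<eta>) \<phi> = 0"
      using kin \<phi> unfolding kinetic_formulation_def by blast
    then show ?thesis by (simp add: distr_dir_deriv_def D_def)
  qed
  finally show ?thesis by (simp add: D_def)
qed


section \<open>Classification of kinetic solutions\<close>

theorem theorem8:
  fixes \<Omega> :: "(real ^ 'n) set" and u :: "real ^ 'n \<Rightarrow> real ^ 'n"
  assumes "CARD('n) \<ge> 3"
    and "open \<Omega>" and "connected \<Omega>"
    and "u \<in> borel_measurable (lebesgue_on \<Omega>)"
    and "\<not> (\<exists>c. AE x in lebesgue_on \<Omega>. u x = c)"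
    and "AE x in lebesgue_on \<Omega>. norm (u x) = 1"
    and "kinetic_formulation \<Omega> u"
  shows "\<exists>P. \<exists>\<gamma>\<in>{1, -1::real}. AE x in lebesgue_on \<Omega>. u x = \<gamma> *\<^sub>R vortex (x - P)"
proof -
  have dim: "DIM(real ^ 'n) \<ge> 3" using assms(1) by simp
  have "\<Omega> \<noteq> {}" using assms(5) by (auto simp: AE_lebesgue_on_iff)
  have "(\<lambda>x. indicator \<Omega> x *\<^sub>R u x) \<in> borel_measurable lebesgue"
    using assms(2,4) by (subst borel_measurable_restrict_space_iff[symmetric]) auto
  from lebesgue_ex_borel_measurable[OF this] obtain g
    where g: "g \<in> borel_measurable borel" "AE x in lborel. indicator \<Omega> x *\<^sub>R u x = g x"
    by blast
  have ug: "AE x in lborel. x \<in> \<Omega> \<longrightarrow> u x = g x"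
    using g(2) by eventually_elim auto
  have unit: "AE x in lborel. x \<in> \<Omega> \<longrightarrow> norm (g x) = 1"
    using ug assms(6)[unfolded AE_lebesgue_on_iff[OF assms(2)]] by eventually_elim auto
  have local: "\<exists>r>0. \<exists>f\<in>const_or_vortex. AE z in lborel. z \<in> ball x r \<longrightarrow> g z = f z"
    if "x \<in> \<Omega>" for x
  proof -
    obtain r where r: "r > 0" "ball x r \<subseteq> \<Omega>"
      using assms(2) \<open>x \<in> \<Omega>\<close> by (meson openE)
    have test: "test_functions (ball x r) \<subseteq> test_functions \<Omega>"
      using r(2) by (auto simp: test_functions_def)
    have "AE y in lborel. AE z in lborel. y \<in> ball x r \<and> z \<in> ball x r \<longrightarrow>
        (\<exists>\<kappa>>0. \<exists>\<mu>. g y - \<kappa> *\<^sub>R g z = \<mu> *\<^sub>R (y - z))"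
    proof (rule AE_pairs_coplanar[OF g(1) open_ball convex_ball])
      fix \<phi> and w \<xi> :: "real ^ 'n"
      assume "\<phi> \<in> test_functions (ball x r)" "w \<bullet> \<xi> = 0"
      with test show "(\<integral>y. chi g y \<xi> * frechet_derivative \<phi> (at y) w \<partial>lborel) = 0"
        by (intro kinetic_formulation_borel[OF assms(2,7,4) g(1)])
           (auto simp: AE_lebesgue_on_iff[OF assms(2)] ug)
    qed
    moreover have "AE y in lborel. y \<in> ball x r \<longrightarrow> norm (g y) = 1"
      using unit by eventually_elim (use r in auto)
    ultimately show ?thesis
      using const_or_vortex_if_coplanar[OF dim] r(1) by blast
  qed
  have "\<exists>f\<in>const_or_vortex. AE x in lborel. x \<in> \<Omega> \<longrightarrow> g x = f x"
    by (rule AE_glue_connected[OF assms(3) const_or_vortex_AE_distinct local \<open>\<Omega> \<noteq> {}\<close>])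
       (use dim in simp)
  then obtain f where f: "f \<in> const_or_vortex" "AE x in lborel. x \<in> \<Omega> \<longrightarrow> g x = f x"
    by (rule bexE)
  have uf: "AE x in lebesgue_on \<Omega>. u x = f x"
    unfolding AE_lebesgue_on_iff[OF assms(2)] using ug f(2) by eventually_elim simp
  from f(1) show ?thesis
  proof (cases rule: const_or_vortexE)
    case (const c)
    show ?thesis using uf assms(5) unfolding const by blast
  next
    case (vortex P \<gamma>)
    show ?thesis using uf vortex(1) unfolding vortex(2) by blast
  qed
qed

end
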